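(* The quaternion cosine function $z\mapsto \cos z$ is $\mathbb{H}$-differentiable at every $z\in\mathbb{H}$, and its $\mathbb{H}$-derivative satisfies $$(\cos z)'=-\sin z .$$
   Context: $\mathbb{H}$ denotes the algebra of real quaternions with its usual norm $|\cdot|$. For $z\in\mathbb{H}$, $\sin z=z-\frac{z^3}{3!}+\frac{z^5}{5!}-\cdots$ and $\cos z=1-\frac{z^2}{2!}+\frac{z^4}{4!}-\cdots$. A quaternion function $f$ defined on a neighborhood $G\subset\mathbb{H}$ of a point $z^0$ is called $\mathbb{H}$-differentiable at $z^0$ if there exist two (finite or infinite) sequences of quaternions $A_k=A_k(z^0)$, $B_k=B_k(z^0)$ such that $\sum_k A_kB_k$ is finite (converges) and, for $z^0+h\in G$, $$f(z^0+h)-f(z^0)=\sum_k A_k\, h\, B_k+\omega(z^0,h),\qquad \lim_{h\to0}\frac{|\omega(z^0,h)|}{|h|}=0.$$ In this case the quaternion $f'(z^0)=\sum_k A_kB_k$ is called the $\mathbb{H}$-derivative of $f$ at $z^0$. *)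

theory Defs
  imports "HOL-Analysis.Analysis"
begin

section \<open>The algebra of real quaternions\<close>

codatatype quat = Quat (qRe: real) (qIm1: real) (qIm2: real) (qIm3: real)

lemma quat_eq_iff:
  "x = y \<longleftrightarrow> qRe x = qRe y \<and> qIm1 x = qIm1 y \<and> qIm2 x = qIm2 y \<and> qIm3 x = qIm3 y"
  by (auto intro: quat.expand)

instantiation quat :: ab_group_add
begin

primcorec zero_quat where
  "qRe 0 = 0" | "qIm1 0 = 0" | "qIm2 0 = 0" | "qIm3 0 = 0"

primcorec plus_quat where
  "qRe (x + y) = qRe x + qRe y"
| "qIm1 (x + y) = qIm1 x + qIm1 y"
| "qIm2 (x + y) = qIm2 x + qIm2 y"
| "qIm3 (x + y) = qIm3 x + qIm3 y"

primcorec uminus_quat where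
  "qRe (- x) = - qRe x"
| "qIm1 (- x) = - qIm1 x"
| "qIm2 (- x) = - qIm2 x"
| "qIm3 (- x) = - qIm3 x"

primcorec minus_quat where
  "qRe (x - y) = qRe x - qRe y"
| "qIm1 (x - y) = qIm1 x - qIm1 y"
| "qIm2 (x - y) = qIm2 x - qIm2 y"
| "qIm3 (x - y) = qIm3 x - qIm3 y"

instance
  by standard (simp_all add: quat_eq_iff)

end

text \<open>Hamilton's multiplication: the last three coordinates refer to units \<open>i, j, k\<close> with
  \<open>i\<^sup>2 = j\<^sup>2 = k\<^sup>2 = i j k = -1\<close>.\<close>

instantiation quat :: ring_1
begin

primcorec one_quat where
  "qRe 1 = 1" | "qIm1 1 = 0" | "qIm2 1 = 0" | "qIm3 1 = 0"

primcorec times_quat where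
  "qRe (x * y) = qRe x * qRe y - qIm1 x * qIm1 y - qIm2 x * qIm2 y - qIm3 x * qIm3 y"
| "qIm1 (x * y) = qRe x * qIm1 y + qIm1 x * qRe y + qIm2 x * qIm3 y - qIm3 x * qIm2 y"
| "qIm2 (x * y) = qRe x * qIm2 y - qIm1 x * qIm3 y + qIm2 x * qRe y + qIm3 x * qIm1 y"
| "qIm3 (x * y) = qRe x * qIm3 y + qIm1 x * qIm2 y - qIm2 x * qIm1 y + qIm3 x * qRe y"

instance
  by standard (simp_all add: quat_eq_iff algebra_simps)

end

lemma Hamilton_relations:
  "Quat 0 1 0 0 * Quat 0 1 0 0 = - 1"
  "Quat 0 0 1 0 * Quat 0 0 1 0 = - 1"
  "Quat 0 0 0 1 * Quat 0 0 0 1 = - 1"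
  "Quat 0 1 0 0 * Quat 0 0 1 0 * Quat 0 0 0 1 = - 1"
  by (simp_all add: quat_eq_iff)

instantiation quat :: real_algebra_1
begin

primcorec scaleR_quat where
  "qRe (scaleR r x) = r * qRe x"
| "qIm1 (scaleR r x) = r * qIm1 x"
| "qIm2 (scaleR r x) = r * qIm2 x"
| "qIm3 (scaleR r x) = r * qIm3 x"

instance
  by standard (simp_all add: quat_eq_iff algebra_simps)

end

instantiation quat :: real_inner
begin

definition inner_quat :: "quat \<Rightarrow> quat \<Rightarrow> real" where
  "inner_quat x y = qRe x * qRe y + qIm1 x * qIm1 y + qIm2 x * qIm2 y + qIm3 x * qIm3 y"

definition norm_quat :: "quat \<Rightarrow> real" where
  "norm_quat x = sqrt ((qRe x)\<^sup>2 + (qIm1 x)\<^sup>2 + (qIm2 x)\<^sup>2 + (qIm3 x)\<^sup>2)"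

definition sgn_quat :: "quat \<Rightarrow> quat" where
  "sgn_quat x = x /\<^sub>R norm x"

definition dist_quat :: "quat \<Rightarrow> quat \<Rightarrow> real" where
  "dist_quat x y = norm (x - y)"

definition uniformity_quat :: "(quat \<times> quat) filter" where
  "uniformity_quat = (INF e\<in>{0 <..}. principal {(x, y). dist x y < e})"

definition open_quat :: "quat set \<Rightarrow> bool" where
  "open_quat U \<longleftrightarrow> (\<forall>x\<in>U. eventually (\<lambda>(x', y). x' = x \<longrightarrow> y \<in> U) uniformity)"

instance
proof
  fix x y z :: quat and r :: real
  show "dist x y = norm (x - y)" by (rule dist_quat_def)
  show "sgn x = x /\<^sub>R norm x" by (rule sgn_quat_def)
  show "uniformity = (INF e\<in>{0 <..}. principal {(x, y). dist x (y::quat) < e})"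
    by (rule uniformity_quat_def)
  show "open U \<longleftrightarrow> (\<forall>x\<in>U. eventually (\<lambda>(x', y). x' = x \<longrightarrow> y \<in> U) uniformity)"
    for U :: "quat set" by (rule open_quat_def)
  show "inner x y = inner y x" by (simp add: inner_quat_def algebra_simps)
  show "inner (x + y) z = inner x z + inner y z" by (simp add: inner_quat_def algebra_simps)
  show "inner (r *\<^sub>R x) y = r * inner x y" by (simp add: inner_quat_def algebra_simps)
  show "0 \<le> inner x x" by (simp add: inner_quat_def)
  show "inner x x = 0 \<longleftrightarrow> x = 0"
    by (auto simp: inner_quat_def quat_eq_iff add_nonneg_eq_0_iff)
  show "norm x = sqrt (inner x x)"
    by (simp add: inner_quat_def norm_quat_def power2_eq_square)
qed

end

instantiation quat :: real_normed_div_algebra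
begin

text \<open>The conjugate divided by the squared norm.\<close>

definition inverse_quat :: "quat \<Rightarrow> quat" where
  "inverse_quat x = Quat (qRe x) (- qIm1 x) (- qIm2 x) (- qIm3 x) /\<^sub>R (norm x)\<^sup>2"

definition divide_quat :: "quat \<Rightarrow> quat \<Rightarrow> quat" where
  "divide_quat x y = x * inverse y"

instance
proof
  fix x y :: quat
  have sq: "(norm x)\<^sup>2 = qRe x * qRe x + qIm1 x * qIm1 x + qIm2 x * qIm2 x + qIm3 x * qIm3 x"
    for x :: quat
    by (simp add: norm_quat_def power2_eq_square)
  have c1: "Quat (qRe x) (- qIm1 x) (- qIm2 x) (- qIm3 x) * x = (norm x)\<^sup>2 *\<^sub>R 1"
    and c2: "x * Quat (qRe x) (- qIm1 x) (- qIm2 x) (- qIm3 x) = (norm x)\<^sup>2 *\<^sub>R 1"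
    by (simp_all add: quat_eq_iff sq algebra_simps)
  show "inverse x * x = 1" if "x \<noteq> 0"
    using that by (simp add: inverse_quat_def c1)
  show "x * inverse x = 1" if "x \<noteq> 0"
    using that by (simp add: inverse_quat_def c2)
  show "x div y = x * inverse y" by (rule divide_quat_def)
  show "inverse (0::quat) = 0" by (simp add: inverse_quat_def)
  have "(norm (x * y))\<^sup>2 = (norm x * norm y)\<^sup>2"
    unfolding power_mult_distrib sq by (simp add: algebra_simps)
  then show "norm (x * y) = norm x * norm y"
    by (rule power2_eq_imp_eq) simp_all
qed

end

instantiation quat :: euclidean_space
begin

definition Basis_quat :: "quat set" where
  "Basis_quat = {Quat 1 0 0 0, Quat 0 1 0 0, Quat 0 0 1 0, Quat 0 0 0 1}"

lemma inner_Basis_quat: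
  "u \<in> Basis \<Longrightarrow> v \<in> Basis \<Longrightarrow> inner u v = (if u = v then 1 else (0::real))" for u v :: quat
  unfolding Basis_quat_def inner_quat_def by (elim insertE emptyE) simp_all

lemma inner_Basis_quat_zero: "(\<forall>u\<in>Basis. inner x u = 0) \<longleftrightarrow> x = 0" for x :: quat
  unfolding Basis_quat_def inner_quat_def
  by (subst quat_eq_iff) (simp only: ball_simps quat.sel zero_quat.sel mult_zero_right
    mult_1_right add_0_left add_0_right simp_thms)

instance
proof
  show "(Basis :: quat set) \<noteq> {}" by (simp add: Basis_quat_def)
  show "finite (Basis :: quat set)" by (simp add: Basis_quat_def)
qed (rule inner_Basis_quat inner_Basis_quat_zero; assumption?)+

end

section \<open>Quaternionic sine and cosine\<close>

text \<open>The library's \<open>sin\<close> and \<open>cos\<close> require a commutative algebra.\<close>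

definition qsin :: "quat \<Rightarrow> quat" where
  "qsin z = (\<Sum>n. ((- 1) ^ n / fact (2 * n + 1)) *\<^sub>R z ^ (2 * n + 1))"

definition qcos :: "quat \<Rightarrow> quat" where
  "qcos z = (\<Sum>n. ((- 1) ^ n / fact (2 * n)) *\<^sub>R z ^ (2 * n))"

lemma qsin_sums: "(\<lambda>n. ((- 1) ^ n / fact (2 * n + 1)) *\<^sub>R z ^ (2 * n + 1)) sums qsin z"
proof -
  have "summable ((\<lambda>n. norm z ^ n / fact n) \<circ> (\<lambda>n. 2 * n + 1))"
    using summable_exp[of "norm z"]
    by (intro summable_reindex) (auto simp: inj_on_def field_simps)
  then have "summable (\<lambda>n. norm (((- 1) ^ n / fact (2 * n + 1)) *\<^sub>R z ^ (2 * n + 1)))"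
    by (simp add: o_def norm_power norm_mult power_abs)
  then show ?thesis
    unfolding qsin_def by (rule summable_sums[OF summable_norm_cancel])
qed

lemma qcos_sums: "(\<lambda>n. ((- 1) ^ n / fact (2 * n)) *\<^sub>R z ^ (2 * n)) sums qcos z"
proof -
  have "summable ((\<lambda>n. norm z ^ n / fact n) \<circ> (\<lambda>n. 2 * n))"
    using summable_exp[of "norm z"]
    by (intro summable_reindex) (auto simp: inj_on_def field_simps)
  then have "summable (\<lambda>n. norm (((- 1) ^ n / fact (2 * n)) *\<^sub>R z ^ (2 * n)))"
    by (simp add: o_def norm_power norm_mult power_abs)
  then show ?thesis
    unfolding qcos_def by (rule summable_sums[OF summable_norm_cancel])
qed

section \<open>Quaternionic differentiability\<close>

text \<open>The function \<open>f\<close> is considered on the neighbourhood \<open>G\<close> of \<open>z0\<close>. A finite sequence of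
  coefficients is the same as an infinite one padded with zeros. Convergence of
  \<open>\<Sum>k. A k * h * B k\<close> is implicit in the expansion of \<open>f\<close> and has to be
  required explicitly, since \<open>suminf\<close> is total.\<close>

definition has_H_derivative :: "(quat \<Rightarrow> quat) \<Rightarrow> quat set \<Rightarrow> quat \<Rightarrow> quat \<Rightarrow> bool" where
  "has_H_derivative f G z0 D \<longleftrightarrow>
     z0 \<in> interior G \<and>
     (\<exists>A B \<omega>.
        (\<lambda>k::nat. A k * B k) sums D \<and>
        (\<forall>h. z0 + h \<in> G \<longrightarrow>
           summable (\<lambda>k. A k * h * B k) \<and>
           f (z0 + h) - f z0 = (\<Sum>k. A k * h * B k) + \<omega> h) \<and>
        ((\<lambda>h. norm (\<omega> h) / norm h) \<longlongrightarrow> 0) (at 0))"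

text \<open>The derivative is unique: it is the directional derivative along the real axis.\<close>

lemma has_H_derivative_imp_real_direction:
  assumes "has_H_derivative f G z0 D"
  shows "((\<lambda>t. (f (z0 + of_real t) - f z0) /\<^sub>R t) \<longlongrightarrow> D) (at (0::real))"
proof -
  obtain A B :: "nat \<Rightarrow> quat" and \<omega> where
      G: "z0 \<in> interior G"
    and D: "(\<lambda>k. A k * B k) sums D"
    and e: "\<And>h. z0 + h \<in> G \<Longrightarrow> f (z0 + h) - f z0 = (\<Sum>k. A k * h * B k) + \<omega> h"
    and w: "((\<lambda>h. norm (\<omega> h) / norm h) \<longlongrightarrow> 0) (at 0)"
    using assms unfolding has_H_derivative_def by blast
  have lim0: "filterlim (of_real :: real \<Rightarrow> quat) (at 0) (at 0)"
    unfolding filterlim_at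
    by (auto intro!: tendsto_eq_intros simp: eventually_at_filter)
  have "((\<lambda>t. z0 + of_real t) \<longlongrightarrow> z0 + of_real 0) (at (0::real))"
    by (intro tendsto_intros)
  then have ev: "eventually (\<lambda>t. z0 + of_real t \<in> interior G) (at (0::real))"
    using G by (auto dest!: topological_tendstoD[OF _ open_interior])
  have "((\<lambda>t. norm (\<omega> (of_real t)) / norm (of_real t :: quat)) \<longlongrightarrow> 0) (at (0::real))"
    by (rule filterlim_compose[OF w lim0])
  then have "((\<lambda>t. norm (\<omega> (of_real t) /\<^sub>R t)) \<longlongrightarrow> 0) (at (0::real))"
    by (simp add: divide_inverse mult.commute)
  then have "((\<lambda>t. D + \<omega> (of_real t) /\<^sub>R t) \<longlongrightarrow> D + 0) (at (0::real))"
    by (intro tendsto_add tendsto_const) (rule tendsto_norm_zero_cancel)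
  moreover have "eventually (\<lambda>t. D + \<omega> (of_real t) /\<^sub>R t = (f (z0 + of_real t) - f z0) /\<^sub>R t)
      (at (0::real))"
    using ev eventually_neq_at_within[of 0]
  proof eventually_elim
    case (elim t)
    have "(\<lambda>k. A k * of_real t * B k) sums (t *\<^sub>R D)"
      using sums_scaleR_right[OF D, of t] by (simp add: of_real_def)
    then show ?case
      using e[of "of_real t"] elim interior_subset[of G]
      by (auto simp: sums_iff scaleR_add_right)
  qed
  ultimately show ?thesis
    by (auto intro: Lim_transform_eventually)
qed

lemma has_H_derivative_unique:
  "has_H_derivative f G z0 D \<Longrightarrow> has_H_derivative f G z0 D' \<Longrightarrow> D = D'"
  by (rule tendsto_unique[OF _ has_H_derivative_imp_real_direction
        has_H_derivative_imp_real_direction]) simp_all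

definition H_differentiable :: "(quat \<Rightarrow> quat) \<Rightarrow> quat set \<Rightarrow> quat \<Rightarrow> bool" where
  "H_differentiable f G z0 \<longleftrightarrow> (\<exists>D. has_H_derivative f G z0 D)"

definition H_deriv :: "(quat \<Rightarrow> quat) \<Rightarrow> quat set \<Rightarrow> quat \<Rightarrow> quat" where
  "H_deriv f G z0 = (THE D. has_H_derivative f G z0 D)"

lemma H_deriv_eq: "has_H_derivative f G z0 D \<Longrightarrow> H_deriv f G z0 = D"
  unfolding H_deriv_def by (rule the_equality) (assumption, rule has_H_derivative_unique)

end

theory Submission imports Defs begin

text \<open>The cosine is an everywhere convergent power series with real coefficients, so it may be
  differentiated termwise over the reals, the derivative of \<open>z\<^sup>n\<close> being \<open>h \<mapsto> \<Sum>i<n. z\<^sup>i h z\<^sup>n\<^sup>-\<^sup>1\<^sup>-\<^sup>i\<close>. On the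
  other hand, every real-linear map \<open>L\<close> on the quaternions is a finite sum \<open>h \<mapsto> \<Sum>k. A\<^sub>k h B\<^sub>k\<close>,
  because \<open>x \<mapsto> Re x\<close> is one: \<open>4 Re x = x - ixi - jxj - kxk\<close>. Hence Frechet differentiability
  implies \<open>H\<close>-differentiability, with \<open>H\<close>-derivative \<open>\<Sum>k. A\<^sub>k B\<^sub>k = L 1\<close>; this is where the
  noncommutative derivative of \<open>z\<^sup>n\<close> collapses to \<open>n z\<^sup>n\<^sup>-\<^sup>1\<close>.\<close>

section \<open>Power series in a noncommutative Banach algebra\<close>

lemma has_derivative_power_noncomm:
  fixes x :: "'a::real_normed_algebra_1"
  shows "((\<lambda>x. x ^ n) has_derivative (\<lambda>h. \<Sum>i<n. x ^ i * h * x ^ (n - 1 - i))) (at x within S)"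
proof (induction n)
  case 0
  show ?case by simp
next
  case (Suc n)
  \<comment> \<open>Splitting off the summand \<open>i = 0\<close> yields the shape of the product
    rule for \<open>x * x ^ n\<close>.\<close>
  have "(\<Sum>i<Suc n. x ^ i * h * x ^ (Suc n - 1 - i))
      = x * (\<Sum>i<n. x ^ i * h * x ^ (n - 1 - i)) + h * x ^ n" for h
    by (subst sum.lessThan_Suc_shift) (simp add: sum_distrib_left mult.assoc)
  then show ?case
    using has_derivative_mult[OF has_derivative_ident Suc.IH] by simp
qed

text \<open>Every summand has \<open>n - 1\<close> factors \<open>x\<close> besides
  \<open>h\<close>, and the norm ignores their order, so the commutative bound survives. It is
  uniform in \<open>x\<close> on a ball, as a majorant requires.\<close>

lemma norm_power_derivative_le:
  fixes x :: "'a::real_normed_algebra_1"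
  assumes "norm x \<le> r"
  shows "norm (\<Sum>i<n. x ^ i * h * x ^ (n - 1 - i)) \<le> real n * r ^ (n - 1) * norm h"
proof -
  have r: "0 \<le> r" using assms norm_ge_zero order_trans by blast
  have pow: "norm (x ^ i) \<le> r ^ i" for i
    using norm_power_ineq[of x i] power_mono[OF assms norm_ge_zero, of i] by linarith
  have "norm (x ^ i * h * x ^ (n - 1 - i)) \<le> r ^ (n - 1) * norm h" if "i < n" for i
  proof -
    have "norm (x ^ i * h * x ^ (n - 1 - i)) \<le> norm (x ^ i) * norm h * norm (x ^ (n - 1 - i))"
      by (meson norm_mult_ineq mult_right_mono norm_ge_zero order_trans)
    also have "\<dots> \<le> r ^ i * norm h * r ^ (n - 1 - i)"
      using r by (intro mult_mono pow order_refl) auto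
    also have "\<dots> = r ^ (i + (n - 1 - i)) * norm h"
      by (simp only: power_add ac_simps)
    also have "i + (n - 1 - i) = n - 1" using that by simp
    finally show ?thesis .
  qed
  then have "norm (\<Sum>i<n. x ^ i * h * x ^ (n - 1 - i)) \<le> (\<Sum>i<n. r ^ (n - 1) * norm h)"
    by (intro sum_norm_le) simp
  then show ?thesis by simp
qed

text \<open>A summable majorant on a ball around 0 justifies termwise differentiation. Only
  \<open>L 1\<close> is recorded: 1 commutes with \<open>z\<close>, so in that direction the
  derivative is the familiar \<open>diffs\<close> series.\<close>

lemma has_derivative_entire_powser:
  fixes c :: "nat \<Rightarrow> real" and z :: "'a::{real_normed_algebra_1, banach}"
  assumes entire: "\<And>r. summable (\<lambda>n. c n * r ^ n)"
  obtains L where "((\<lambda>x. \<Sum>n. c n *\<^sub>R x ^ n) has_derivative L) (at z)"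
    and "(\<lambda>n. diffs c n *\<^sub>R z ^ n) sums L 1"
proof -
  define r where "r = norm z + 1"
  have r: "0 < r" by (simp add: r_def add_nonneg_pos)
  define D where "D n x h = c n *\<^sub>R (\<Sum>i<n. x ^ i * h * x ^ (n - 1 - i))" for n and x h :: 'a
  define M where "M n = \<bar>c n\<bar> * (real n * r ^ (n - 1))" for n
  \<comment> \<open>Convergence at the larger radius \<open>r + 1\<close> gives absolute convergence
    at \<open>r\<close>; these terms are the majorant \<open>M\<close>, shifted by one.\<close>
  have "summable (\<lambda>n. diffs c n * (r + 1) ^ n)"
    by (rule termdiff_converges_all) (rule entire)
  then have "summable (\<lambda>n. norm (diffs c n * r ^ n))"
    by (rule powser_insidea) (use r in simp)
  then have "summable (\<lambda>n. M (Suc n))"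
    using r by (simp add: M_def diffs_def abs_mult ac_simps)
  then have M: "summable M"
    by (simp only: summable_Suc_iff)
  have bound: "norm (D n x h) \<le> M n * norm h" if "norm x \<le> r" for n x h
    using mult_left_mono[OF norm_power_derivative_le[OF that, where n = n and h = h], of "\<bar>c n\<bar>"]
    by (simp add: D_def M_def ac_simps)
  have sumD: "summable (\<lambda>n. D n x h)" if "norm x \<le> r" for x h
    by (rule summable_comparison_test'[OF summable_mult2[OF M]]) (rule bound[OF that])
  \<comment> \<open>\<open>has_derivative_series\<close> also needs the original series to converge
    at one point of the ball; \<open>z\<close> serves.\<close>
  have "summable (\<lambda>n. norm (c n * norm z ^ n))"
    by (rule powser_insidea[OF entire[of r]]) (simp add: r_def)
  then have sumz: "summable (\<lambda>n. c n *\<^sub>R z ^ n)"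
    by (rule summable_comparison_test'[where N = 0])
      (simp add: abs_mult mult_left_mono norm_power_ineq)
  have "\<exists>g. \<forall>x\<in>ball 0 r. (\<lambda>n. c n *\<^sub>R x ^ n) sums g x \<and>
      (g has_derivative (\<lambda>h. \<Sum>n. D n x h)) (at x within ball 0 r)"
  proof (rule has_derivative_series)
    show "((\<lambda>x. c n *\<^sub>R x ^ n) has_derivative D n x) (at x within ball 0 r)" for n and x :: 'a
      unfolding D_def by (intro has_derivative_scaleR_right has_derivative_power_noncomm)
    show "\<forall>\<^sub>F n in sequentially. \<forall>x\<in>ball 0 r. \<forall>h.
        norm ((\<Sum>i<n. D i x h) - (\<Sum>i. D i x h)) \<le> e * norm h" if "e > 0" for e
    proof -
      \<comment> \<open>The tail of \<open>M\<close> depends on neither \<open>x\<close> nor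
        \<open>h\<close>, which makes the estimate uniform.\<close>
      have "\<forall>\<^sub>F n in sequentially. norm (\<Sum>i. M (i + n)) < e"
        using suminf_exist_split[OF that M] by (auto simp: eventually_sequentially)
      then show ?thesis
      proof eventually_elim
        case (elim n)
        show ?case
        proof (intro ballI allI)
          fix x h :: 'a
          assume "x \<in> ball 0 r"
          then have x: "norm x \<le> r" by simp
          have Mn: "summable (\<lambda>i. M (i + n))" using M by (rule summable_ignore_initial_segment)
          have "norm ((\<Sum>i<n. D i x h) - (\<Sum>i. D i x h)) = norm (\<Sum>i. D (i + n) x h)"
            using suminf_split_initial_segment[OF sumD[OF x], of h n]
            by (simp add: norm_minus_commute)
          also have "\<dots> \<le> (\<Sum>i. M (i + n) * norm h)"
            by (rule norm_suminf_le[OF bound[OF x] summable_mult2[OF Mn]])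
          also have "\<dots> = (\<Sum>i. M (i + n)) * norm h"
            by (rule suminf_mult2[OF Mn, symmetric])
          also have "\<dots> \<le> e * norm h"
            using elim by (intro mult_right_mono) auto
          finally show "norm ((\<Sum>i<n. D i x h) - (\<Sum>i. D i x h)) \<le> e * norm h" .
        qed
      qed
    qed
    show "(\<lambda>n. c n *\<^sub>R z ^ n) sums (\<Sum>n. c n *\<^sub>R z ^ n)"
      using sumz by (rule summable_sums)
    show "z \<in> ball 0 r" by (simp add: r_def)
  qed simp
  then obtain g where g: "\<And>x. x \<in> ball 0 r \<Longrightarrow> (\<lambda>n. c n *\<^sub>R x ^ n) sums g x"
    and g': "\<And>x. x \<in> ball 0 r \<Longrightarrow> (g has_derivative (\<lambda>h. \<Sum>n. D n x h)) (at x within ball 0 r)"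
    by blast
  have z: "z \<in> ball 0 r" by (simp add: r_def)
  have "(g has_derivative (\<lambda>h. \<Sum>n. D n z h)) (at z)"
    using g'[OF z] at_within_open[OF z open_ball] by simp
  then have "((\<lambda>x. \<Sum>n. c n *\<^sub>R x ^ n) has_derivative (\<lambda>h. \<Sum>n. D n z h)) (at z)"
    by (rule has_derivative_transform_within_open[OF _ open_ball z]) (use g in \<open>simp add: sums_iff\<close>)
  moreover have "(\<lambda>n. diffs c n *\<^sub>R z ^ n) sums (\<Sum>n. D n z 1)"
  proof -
    have "D (Suc n) z 1 = diffs c n *\<^sub>R z ^ n" for n
    proof -
      \<comment> \<open>With \<open>h = 1\<close> the powers of \<open>z\<close> merge, and all
        \<open>Suc n\<close> summands equal \<open>z ^ n\<close>.\<close>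
      have "(\<Sum>i<Suc n. z ^ i * 1 * z ^ (Suc n - 1 - i)) = (\<Sum>i<Suc n. z ^ n)"
        by (intro sum.cong refl) (simp flip: power_add)
      then show ?thesis
        by (simp add: D_def diffs_def scaleR_conv_of_real ac_simps)
    qed
    moreover have "D 0 z 1 = 0" by (simp add: D_def)
    ultimately show ?thesis
      using summable_sums[OF sumD[of z 1]] sums_Suc_iff[of "\<lambda>n. D n z 1"] by (simp add: r_def)
  qed
  ultimately show ?thesis by (rule that)
qed

section \<open>Real-linear maps on the quaternions\<close>

text \<open>Of the four conjugations by 1, i, j, k, two fix a given imaginary unit and two negate
  it, so summing \<open>f * q * inverse f\<close> leaves 4 Re q. For
  \<open>q = inverse e * h\<close> this real part is \<open>h \<bullet> e\<close>, as
  \<open>inverse e\<close> is the conjugate of the unit \<open>e\<close>.\<close>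

lemma sum_Basis_quat_conjugate:
  fixes e h :: quat
  assumes "e \<in> Basis"
  shows "(\<Sum>f\<in>Basis. f * (inverse e * h) * inverse f) = of_real (4 * (h \<bullet> e))"
  using assms unfolding Basis_quat_def
  by (auto simp: quat_eq_iff inverse_quat_def norm_quat_def inner_quat_def of_real_def)

text \<open>Each coordinate \<open>h \<bullet> e\<close> is a two-sided sum by the preceding
  identity; multiplying it on the left by \<open>L e\<close> keeps that form. The pairs
  \<open>(e, f)\<close> are then enumerated by \<open>u\<close>.\<close>

lemma linear_quat_two_sided:
  fixes L :: "quat \<Rightarrow> quat"
  assumes "linear L"
  obtains n and A B :: "nat \<Rightarrow> quat" where "\<And>h. L h = (\<Sum>k<n. A k * h * B k)"
proof -
  let ?I = "Basis \<times> Basis :: (quat \<times> quat) set"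
  let ?a = "\<lambda>(e, f). (1 / 4) *\<^sub>R (L e * f * inverse e)" and ?b = "\<lambda>(e, f). inverse f"
  obtain u where u: "bij_betw u {..<card ?I} ?I"
    using ex_bij_betw_nat_finite[of ?I] by (auto simp: lessThan_atLeast0)
  have "L h = (\<Sum>k<card ?I. ?a (u k) * h * ?b (u k))" for h
  proof -
    have "L h = (\<Sum>e\<in>Basis. (h \<bullet> e) *\<^sub>R L e)"
      by (metis (no_types, lifting) Linear_Algebra.linear_componentwise assms euclidean_representation
          linear_sum linear_scale sum.cong)
    also have "\<dots> = (\<Sum>e\<in>Basis. (1 / 4) *\<^sub>R (L e * (\<Sum>f\<in>Basis. f * (inverse e * h) * inverse f)))"
      by (intro sum.cong refl) (simp add: sum_Basis_quat_conjugate of_real_def)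
    also have "\<dots> = (\<Sum>e\<in>Basis. \<Sum>f\<in>Basis. ?a (e, f) * h * ?b (e, f))"
      by (simp add: sum_distrib_left scaleR_sum_right mult.assoc)
    also have "\<dots> = (\<Sum>p\<in>?I. ?a p * h * ?b p)"
      by (simp add: sum.cartesian_product case_prod_beta)
    also have "\<dots> = (\<Sum>k<card ?I. ?a (u k) * h * ?b (u k))"
      by (rule sum.reindex_bij_betw[OF u, symmetric])
    finally show ?thesis .
  qed
  then show ?thesis by (rule that)
qed

lemma has_derivative_imp_has_H_derivative:
  assumes f: "(f has_derivative L) (at z)" and z: "z \<in> interior G"
  shows "has_H_derivative f G z (L 1)"
proof -
  obtain n and A B :: "nat \<Rightarrow> quat" where L: "\<And>h. L h = (\<Sum>k<n. A k * h * B k)"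
    using linear_quat_two_sided[OF has_derivative_linear[OF f]] by blast
  \<comment> \<open>Padding \<open>A\<close> with zeros kills all terms beyond \<open>n\<close>,
    whatever \<open>B\<close> is there.\<close>
  define A' where "A' k = (if k < n then A k else 0)" for k
  have sums: "(\<lambda>k. A' k * h * B k) sums L h" for h
    using sums_finite[of "{..<n}" "\<lambda>k. A' k * h * B k"] by (simp add: A'_def L)
  have "((\<lambda>h. norm (f (z + h) - f z - L h) / norm h) \<longlongrightarrow> 0) (at 0)"
    using f by (simp add: has_derivative_at)
  then show ?thesis
    unfolding has_H_derivative_def
    using z sums[of 1] sums
    by (intro conjI exI[of _ A'] exI[of _ B] exI[of _ "\<lambda>h. f (z + h) - f z - L h"])
      (auto simp: sums_iff)
qed

section \<open>The quaternionic cosine\<close>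

text \<open>The zero odd coefficients are filled in so that the result on entire power series
  applies.\<close>

lemma qcos_powser: "qcos z = (\<Sum>n. cos_coeff n *\<^sub>R z ^ n)"
proof -
  have "(\<lambda>n. cos_coeff (2 * n) *\<^sub>R z ^ (2 * n)) sums qcos z"
    using qcos_sums[of z] by (simp add: cos_coeff_def)
  moreover have "cos_coeff n *\<^sub>R z ^ n = 0" if "n \<notin> range ((*) 2)" for n
    using that by (auto simp: cos_coeff_def elim!: evenE)
  ultimately have "(\<lambda>n. cos_coeff n *\<^sub>R z ^ n) sums qcos z"
    by (subst (asm) sums_mono_reindex[where f = "\<lambda>n. cos_coeff n *\<^sub>R z ^ n"])
      (auto simp: strict_mono_def)
  then show ?thesis by (simp add: sums_iff)
qed

lemma sin_coeff_sums_qsin: "(\<lambda>n. sin_coeff n *\<^sub>R z ^ n) sums qsin z"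
proof -
  have "(\<lambda>n. sin_coeff (2 * n + 1) *\<^sub>R z ^ (2 * n + 1)) sums qsin z"
    using qsin_sums[of z] by (simp add: sin_coeff_def)
  moreover have "sin_coeff n *\<^sub>R z ^ n = 0" if "n \<notin> range (\<lambda>n. 2 * n + 1)" for n
    using that by (auto simp: sin_coeff_def elim!: oddE)
  ultimately show ?thesis
    by (subst (asm) sums_mono_reindex[where f = "\<lambda>n. sin_coeff n *\<^sub>R z ^ n"])
      (auto simp: strict_mono_def)
qed

lemma has_H_derivative_qcos:
  assumes "z \<in> interior G"
  shows "has_H_derivative qcos G z (- qsin z)"
proof -
  have "summable (\<lambda>n. cos_coeff n * r ^ n)" for r :: real
    using summable_norm_cancel[OF summable_norm_cos[of r]] by simp
  then obtain L where L: "((\<lambda>x. \<Sum>n. cos_coeff n *\<^sub>R x ^ n) has_derivative L) (at z)"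
    and L1: "(\<lambda>n. diffs cos_coeff n *\<^sub>R z ^ n) sums L 1"
    by (rule has_derivative_entire_powser)
  have "L 1 = - qsin z"
    using sums_unique2[OF L1] sums_minus[OF sin_coeff_sums_qsin[of z]] by (simp add: diffs_cos_coeff)
  moreover have "(qcos has_derivative L) (at z)"
    using L by (simp flip: qcos_powser)
  ultimately show ?thesis
    using has_derivative_imp_has_H_derivative[OF _ assms] by metis
qed

theorem proposition2p6:
  fixes z :: quat
  shows "H_differentiable qcos UNIV z \<and> H_deriv qcos UNIV z = - qsin z"
proof -
  have "has_H_derivative qcos UNIV z (- qsin z)"
    by (rule has_H_derivative_qcos) simp
  then show ?thesis
    unfolding H_differentiable_def using H_deriv_eq by blast
qed

end
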